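(* Let $\mathbb{A}\in\mathbb{M}_{d,d'}$ be partitioned into $r$ blocks $A_k\in\mathbb{M}_{n_k,m_k}$, $k=1,\ldots,r$, and assume that the partitioning is row compatible or column compatible. Then there exist isometries $U_k\in\mathbb{M}_{d',m_k}$, $k=1,\ldots,r$, such that $$|\mathbb{A}|^2=\sum_{k=1}^{r} U_k\,|A_k|^2\,U_k^*.$$
   Context: $\mathbb{M}_{n,m}$ is the space of complex $n\times m$ matrices and $\mathbb{M}_n=\mathbb{M}_{n,n}$. For $S\in\mathbb{M}_{n,m}$, $|S|=(S^*S)^{1/2}\in\mathbb{M}_m$ is its absolute value (positive semidefinite). A matrix $U\in\mathbb{M}_{n,m}$ with $m\le n$ is an isometry if $U^*U$ is the identity of $\mathbb{M}_m$. A partitioning of $\mathbb{A}$ into blocks $A_1,\dots,A_r$ is a decomposition of the rectangular array of entries of $\mathbb{A}$ into pairwise disjoint nonempty rectangular blocks (submatrices formed by consecutive rows and consecutive columns) covering all entries; each $A_k$ is regarded both as an $n_k\times m_k$ matrix and as a submatrix with its position in $\mathbb{A}$. The partitioning is column compatible if for all $k,l$ either $A_k$ and $A_l$ lie on the same set of columns of $\mathbb{A}$ or they lie on disjoint sets of columns. It is row compatible if for all $k,l$ either $A_k$ and $A_l$ lie on the same set of rows of $\mathbb{A}$ or they lie on disjoint sets of rows. *)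

theory Defs
  imports
    "HOL-Library.Disjoint_Sets"
    "Jordan_Normal_Form.Schur_Decomposition"
    "Jordan_Normal_Form.DL_Submatrix"
begin

text \<open>The inequality is in the order of \<^typ>\<open>complex\<close>, where \<open>0 \<le> z\<close> says that \<open>z\<close> is real and
  nonnegative; \<open>(P *\<^sub>v v) \<bullet>c v\<close> is \<open>v\<^sup>* P v\<close>.\<close>

definition positive_semidefinite :: "complex mat \<Rightarrow> bool" where
  "positive_semidefinite P \<longleftrightarrow> square_mat P \<and> mat_adjoint P = P \<and>
     (\<forall>v \<in> carrier_vec (dim_row P). 0 \<le> (P *\<^sub>v v) \<bullet>c v)"

text \<open>The value is specified only for positive semidefinite \<open>M\<close>, for which the positive
  semidefinite square root exists and is unique.\<close>

definition psd_sqrt :: "complex mat \<Rightarrow> complex mat" where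
  "psd_sqrt M = (THE P. P \<in> carrier_mat (dim_row M) (dim_row M) \<and>
     positive_semidefinite P \<and> P * P = M)"

definition mat_abs :: "complex mat \<Rightarrow> complex mat" where
  "mat_abs S = psd_sqrt (mat_adjoint S * S)"

definition isometry_mat :: "complex mat \<Rightarrow> bool" where
  "isometry_mat U \<longleftrightarrow> dim_col U \<le> dim_row U \<and> mat_adjoint U * U = 1\<^sub>m (dim_col U)"

definition consecutive :: "nat set \<Rightarrow> bool" where
  "consecutive I \<longleftrightarrow> (\<exists>a b. a < b \<and> I = {a..<b})"

text \<open>A partitioning of a \<open>d \<times> d'\<close> array into \<open>r\<close> blocks is given by the (zero-based) row set
  \<open>R k\<close> and column set \<open>C k\<close> of the \<open>k\<close>-th block, \<open>k < r\<close>; the block itself is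
  \<open>submatrix A (R k) (C k)\<close>. Intervals in \<open>consecutive\<close> are nonempty, hence so are the blocks.\<close>

definition block_partition ::
    "nat \<Rightarrow> nat \<Rightarrow> nat \<Rightarrow> (nat \<Rightarrow> nat set) \<Rightarrow> (nat \<Rightarrow> nat set) \<Rightarrow> bool" where
  "block_partition d d' r R C \<longleftrightarrow>
     (\<forall>k<r. consecutive (R k) \<and> consecutive (C k)) \<and>
     disjoint_family_on (\<lambda>k. R k \<times> C k) {..<r} \<and>
     (\<Union>k<r. R k \<times> C k) = {..<d} \<times> {..<d'}"

definition row_compatible :: "nat \<Rightarrow> (nat \<Rightarrow> nat set) \<Rightarrow> bool" where
  "row_compatible r R \<longleftrightarrow> (\<forall>k<r. \<forall>l<r. R k = R l \<or> R k \<inter> R l = {})"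

definition column_compatible :: "nat \<Rightarrow> (nat \<Rightarrow> nat set) \<Rightarrow> bool" where
  "column_compatible r C \<longleftrightarrow> (\<forall>k<r. \<forall>l<r. C k = C l \<or> C k \<inter> C l = {})"

end

theory Submission
  imports Defs
begin

text \<open>Write \<open>|S|\<^sup>2 = S\<^sup>* S\<close>, and let \<open>H = |A|\<^sup>2 = M M\<close> with \<open>M\<close> the positive semidefinite root of \<open>H\<close>.
The mechanism is the decomposition of a positive semidefinite matrix into its diagonal blocks.
For a set \<open>C\<close> of column indices let \<open>N\<close> be the matrix formed by the columns of \<open>M\<close> in \<open>C\<close>. Since \<open>M\<close> is
Hermitian, \<open>N\<^sup>* N\<close> is the principal block \<open>H[C,C]\<close>, whereas the matrices \<open>N N\<^sup>*\<close>, added over a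
partition of the indices into sets \<open>C\<close>, give \<open>M M = H\<close>. Because \<open>N\<close> has at least as many rows as
columns, \<open>N N\<^sup>* = U (N\<^sup>* N) U\<^sup>*\<close> for an isometry \<open>U\<close> (\<open>isometry_swaps_gram\<close>), and therefore
\<open>H\<close> is the sum of the matrices \<open>U\<^sub>C H[C,C] U\<^sub>C\<^sup>*\<close> (\<open>block_isometry_exists\<close>).

The other ingredient is that stacking rows is additive: the Gram matrix of a set of rows is the sum
of the Gram matrices of the parts of any partition of that set.

If the partitioning is column compatible, the blocks fall into full columns of blocks. One decomposes
\<open>H\<close> along the column sets \<open>C\<close>; \<open>H[C,C]\<close> is the Gram matrix of the columns of \<open>A\<close> in \<open>C\<close>, hence the sum of the
\<open>|A\<^sub>k|\<^sup>2\<close> over the blocks stacked in them, and all these blocks share the isometry \<open>U\<^sub>C\<close>.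
If it is row compatible, the blocks fall into full rows of blocks. Additivity writes \<open>H\<close> as the sum of
the \<open>|S|\<^sup>2\<close> over these strips \<open>S\<close>, and each \<open>|S|\<^sup>2\<close> is decomposed along the column sets of the
blocks in \<open>S\<close>, whose principal blocks are the \<open>|A\<^sub>k|\<^sup>2\<close>.

Square roots and the isometry \<open>U\<close> both come from the spectral theorem for Hermitian matrices, which is
proved by adding orthonormal eigenvectors one at a time
(\<open>extend_orthonormal_eigenvectors\<close>).\<close>

section \<open>Adjoints and inner products\<close>

lemma mat_adjoint_dim [simp]:
  "dim_row (mat_adjoint A) = dim_col A" "dim_col (mat_adjoint A) = dim_row A"
  by (simp_all add: mat_adjoint_def)

lemma mat_adjoint_carrier [simp]: "A \<in> carrier_mat n m \<Longrightarrow> mat_adjoint A \<in> carrier_mat m n"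
  by (rule carrier_matI) simp_all

lemma mat_adjoint_index [simp]:
  fixes A :: "complex mat"
  shows "i < dim_col A \<Longrightarrow> j < dim_row A \<Longrightarrow> mat_adjoint A $$ (i, j) = cnj (A $$ (j, i))"
  by (simp add: mat_adjoint_def mat_of_rows_index conjugate_complex_def)

lemma mult_mat_entry:
  assumes "A \<in> carrier_mat n m" "B \<in> carrier_mat m l" "i < n" "j < l"
  shows "(A * B) $$ (i, j) = (\<Sum>k<m. A $$ (i, k) * B $$ (k, j))"
  using assms by (auto simp: scalar_prod_def lessThan_atLeast0 intro!: sum.cong)

lemma mat_adjoint_adjoint [simp]: "mat_adjoint (mat_adjoint A) = (A :: complex mat)"
  by (rule eq_matI) simp_all

lemma mat_adjoint_mult:
  fixes A B :: "complex mat"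
  assumes A: "A \<in> carrier_mat n m" and B: "B \<in> carrier_mat m l"
  shows "mat_adjoint (A * B) = mat_adjoint B * mat_adjoint A"
proof (rule eq_matI)
  fix i j assume "i < dim_row (mat_adjoint B * mat_adjoint A)" "j < dim_col (mat_adjoint B * mat_adjoint A)"
  with A B have ij: "i < l" "j < n" by auto
  have "mat_adjoint (A * B) $$ (i, j) = cnj ((A * B) $$ (j, i))" using A B ij by simp
  also have "\<dots> = (\<Sum>k<m. mat_adjoint B $$ (i, k) * mat_adjoint A $$ (k, j))"
    using A B ij by (simp add: mult_mat_entry[OF A B ij(2,1)] mult.commute del: index_mult_mat)
  also have "\<dots> = (mat_adjoint B * mat_adjoint A) $$ (i, j)"
    using A B ij by (subst mult_mat_entry[of _ l m _ n]) auto
  finally show "mat_adjoint (A * B) $$ (i, j) = (mat_adjoint B * mat_adjoint A) $$ (i, j)" .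
qed (use A B in simp_all)

lemma mat_adjoint_minus:
  fixes A B :: "complex mat"
  assumes "A \<in> carrier_mat n m" "B \<in> carrier_mat n m"
  shows "mat_adjoint (A - B) = mat_adjoint A - mat_adjoint B"
  using assms by (intro eq_matI) simp_all

lemma cscalar_sum:
  fixes v w :: "complex vec"
  assumes "w \<in> carrier_vec n"
  shows "v \<bullet>c w = (\<Sum>i<n. v $ i * cnj (w $ i))"
  using assms by (simp add: scalar_prod_def lessThan_atLeast0 conjugate_complex_def)

lemma adjoint_mult_entry:
  fixes A B :: "complex mat"
  assumes A: "A \<in> carrier_mat n m" and B: "B \<in> carrier_mat n l" and ij: "i < m" "j < l"
  shows "(mat_adjoint A * B) $$ (i, j) = col B j \<bullet>c col A i"
proof -
  have "(mat_adjoint A * B) $$ (i, j) = (\<Sum>k<n. cnj (A $$ (k, i)) * B $$ (k, j))"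
    using A B ij by (simp add: mult_mat_entry[of _ m n _ l] del: index_mult_mat)
  also have "\<dots> = col B j \<bullet>c col A i"
    using A B ij by (simp add: cscalar_sum[of _ n] mult.commute)
  finally show ?thesis .
qed

lemma cscalar_adjoint:
  fixes A :: "complex mat"
  assumes A: "A \<in> carrier_mat n m" and v: "v \<in> carrier_vec m" and w: "w \<in> carrier_vec n"
  shows "(A *\<^sub>v v) \<bullet>c w = v \<bullet>c (mat_adjoint A *\<^sub>v w)"
proof -
  have "(A *\<^sub>v v) \<bullet>c w = (\<Sum>i<n. \<Sum>j<m. A $$ (i, j) * v $ j * cnj (w $ i))"
    using assms by (auto simp: scalar_prod_def lessThan_atLeast0 conjugate_complex_def sum_distrib_right
        intro!: sum.cong)
  also have "\<dots> = (\<Sum>j<m. \<Sum>i<n. A $$ (i, j) * v $ j * cnj (w $ i))"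
    by (rule sum.swap)
  also have "\<dots> = v \<bullet>c (mat_adjoint A *\<^sub>v w)"
    using assms by (auto simp: scalar_prod_def lessThan_atLeast0 conjugate_complex_def sum_distrib_left
        mult_ac intro!: sum.cong)
  finally show ?thesis .
qed

lemma cscalar_commute:
  fixes v w :: "complex vec"
  assumes "v \<in> carrier_vec n" "w \<in> carrier_vec n"
  shows "w \<bullet>c v = cnj (v \<bullet>c w)"
  using assms by (simp add: cscalar_sum mult.commute)

lemma normalise_vec:
  fixes w :: "complex vec"
  assumes w: "w \<in> carrier_vec n" "w \<noteq> 0\<^sub>v n"
  shows "\<exists>c. c \<noteq> 0 \<and> (c \<cdot>\<^sub>v w) \<bullet>c (c \<cdot>\<^sub>v w) = 1"
proof -
  have "0 < w \<bullet>c w" using conjugate_square_greater_0_vec[OF w(1)] w by simp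
  then obtain r where r: "w \<bullet>c w = complex_of_real r" "r > 0"
    by (metis complex_is_Real_iff less_complex_def of_real_Re zero_complex.sel)
  let ?c = "complex_of_real (1 / sqrt r)"
  have "(?c \<cdot>\<^sub>v w) \<bullet>c (?c \<cdot>\<^sub>v w) = ?c * (?c * (w \<bullet>c w))"
    using w by (simp add: conjugate_smult_vec conjugate_complex_def)
  also have "\<dots> = complex_of_real (1 / sqrt r * (1 / sqrt r * r))"
    unfolding r by (simp only: of_real_mult)
  also have "1 / sqrt r * (1 / sqrt r * r) = 1" using r by (simp add: field_simps)
  finally show ?thesis using r by (intro exI[of _ ?c]) auto
qed

text \<open>The conditions \<open>w \<bullet>c y i = 0\<close> form a square linear system whose row \<open>k\<close> is zero, so its determinant
vanishes and it has a nonzero solution.\<close>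

lemma exists_unit_orthogonal:
  fixes y :: "nat \<Rightarrow> complex vec"
  assumes y: "\<And>i. i \<in> I \<Longrightarrow> y i \<in> carrier_vec n" and I: "k < n" "k \<notin> I" "I \<subseteq> {..<n}"
  shows "\<exists>w \<in> carrier_vec n. w \<bullet>c w = 1 \<and> (\<forall>i\<in>I. w \<bullet>c y i = 0)"
proof -
  define c where "c i = (if i \<in> I then conjugate (y i) else 0\<^sub>v n)" for i
  have c: "c i \<in> carrier_vec n" for i using y by (auto simp: c_def)
  define M where "M = mat\<^sub>r n n (\<lambda>i. if i = k then 0\<^sub>v n else c i)"
  have "det M = 0" unfolding M_def by (rule det_row_0) (use I c in auto)
  moreover have M: "M \<in> carrier_mat n n" by (simp add: M_def)
  ultimately obtain w where w: "w \<in> carrier_vec n" "w \<noteq> 0\<^sub>v n" "M *\<^sub>v w = 0\<^sub>v n"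
    using det_0_iff_vec_prod_zero[OF M] by auto
  have ort: "w \<bullet>c y i = 0" if i: "i \<in> I" for i
  proof -
    have "i < n" "i \<noteq> k" using i I by auto
    then have "row M i = conjugate (y i)"
      using y[OF i] i by (subst M_def, subst row_mat_of_row_fun) (auto simp: c_def)
    then have "conjugate (y i) \<bullet> w = (M *\<^sub>v w) $ i" using \<open>i < n\<close> M by simp
    then show ?thesis using w \<open>i < n\<close> y[OF i] by (simp add: comm_scalar_prod[of _ n])
  qed
  obtain a where a: "(a \<cdot>\<^sub>v w) \<bullet>c (a \<cdot>\<^sub>v w) = 1" using normalise_vec[OF w(1,2)] by blast
  show ?thesis
  proof (intro bexI[of _ "a \<cdot>\<^sub>v w"] conjI ballI)
    fix i assume "i \<in> I"
    then show "(a \<cdot>\<^sub>v w) \<bullet>c y i = 0" using ort y w by simp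
  qed (use a w in auto)
qed

section \<open>Spectral theorem for Hermitian matrices\<close>

text \<open>The trace of \<open>G * G\<close> is the sum of the squared moduli of the entries of \<open>G\<close>, as \<open>G\<close> is Hermitian, and by
Schur triangularisation it is also the sum of the squares of the eigenvalues. If these all vanish, so
does \<open>G\<close>.\<close>

lemma hermitian_nonzero_eigenvalue:
  fixes G :: "complex mat"
  assumes G: "G \<in> carrier_mat n n" and herm: "mat_adjoint G = G" and nz: "G \<noteq> 0\<^sub>m n n"
  shows "\<exists>e w. e \<noteq> 0 \<and> w \<in> carrier_vec n \<and> w \<noteq> 0\<^sub>v n \<and> G *\<^sub>v w = e \<cdot>\<^sub>v w"
proof (rule ccontr)
  assume neg: "\<not> ?thesis"
  obtain es where es: "char_poly G = (\<Prod>a\<leftarrow>es. [:- a, 1:])"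
    using char_poly_factorized[OF G] by blast
  have es0: "e = 0" if "e \<in> set es" for e
  proof -
    have "poly (char_poly G) e = 0"
      unfolding es poly_prod_list using that by (auto simp: prod_list_zero_iff)
    then have "eigenvalue G e" using eigenvalue_root_char_poly[OF G] by simp
    then show "e = 0" using neg G unfolding eigenvalue_def eigenvector_def by auto
  qed
  obtain B P Q where "schur_decomposition G es = (B, P, Q)" by (cases "schur_decomposition G es")
  from schur_decomposition[OF G es this] have sim: "similar_mat_wit G B P Q"
    and ut: "upper_triangular B" and dg: "diag_mat B = es" by auto
  note D = similar_mat_witD2[OF G sim]
  have B0: "B $$ (i, j) * B $$ (j, i) = 0" if "i < n" "j < n" for i j
  proof (cases "i = j")
    case True
    have "B $$ (i, i) \<in> set es" unfolding dg[symmetric] diag_mat_def using D(5) that by auto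
    then show ?thesis using True es0 by simp
  next
    case False
    then show ?thesis using ut D(5) that unfolding upper_triangular_def
      by (metis carrier_matD(1) linorder_neqE_nat mult_zero_left mult_zero_right)
  qed
  have trace_comm: "(\<Sum>i<n. (X * Y) $$ (i, i)) = (\<Sum>i<n. (Y * X) $$ (i, i))"
    if "X \<in> carrier_mat n n" "Y \<in> carrier_mat n n" for X Y :: "complex mat"
  proof -
    have "(\<Sum>i<n. (X * Y) $$ (i, i)) = (\<Sum>i<n. \<Sum>k<n. X $$ (i, k) * Y $$ (k, i))"
      using mult_mat_entry[OF that] by (intro sum.cong) auto
    also have "\<dots> = (\<Sum>k<n. \<Sum>i<n. X $$ (i, k) * Y $$ (k, i))" by (rule sum.swap)
    also have "\<dots> = (\<Sum>i<n. (Y * X) $$ (i, i))"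
      using mult_mat_entry[OF that(2,1)] by (intro sum.cong) (auto simp: mult.commute)
    finally show ?thesis .
  qed
  note assoc = assoc_mult_mat[of _ n n _ n _ n] and closed = mult_carrier_mat[of _ n n _ n]
  have "G * G = P * (B * ((Q * P) * (B * Q)))"
    unfolding D(3) using D(5-7) by (simp add: assoc closed del: assoc_mult_mat)
  also have "\<dots> = P * (B * B * Q)"
    unfolding D(2) using D(5-7) by (simp add: assoc closed del: assoc_mult_mat)
  finally have "G * G = P * (B * B * Q)" .
  then have "(\<Sum>i<n. (G * G) $$ (i, i)) = (\<Sum>i<n. (B * B * Q * P) $$ (i, i))"
    using trace_comm[of P "B * B * Q"] D(5-7) by (simp add: closed del: index_mult_mat)
  also have "B * B * Q * P = B * B" using D(5-7) D(2)
    by (simp add: assoc closed del: assoc_mult_mat)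
  also have "(\<Sum>i<n. (B * B) $$ (i, i)) = 0"
    using B0 by (auto simp: mult_mat_entry[OF D(5) D(5)] simp del: index_mult_mat mult_eq_0_iff
        intro!: sum.neutral)
  also have "(\<Sum>i<n. (G * G) $$ (i, i)) = (\<Sum>i<n. \<Sum>k<n. complex_of_real ((cmod (G $$ (i, k)))\<^sup>2))"
  proof (intro sum.cong refl)
    fix i assume i: "i \<in> {..<n}"
    have "G $$ (i, k) * G $$ (k, i) = complex_of_real ((cmod (G $$ (i, k)))\<^sup>2)" if "k < n" for k
    proof -
      have "G $$ (k, i) = cnj (G $$ (i, k))" using arg_cong[OF herm, of "\<lambda>X. X $$ (k, i)"] G i that by simp
      then show ?thesis by (simp add: complex_norm_square del: of_real_power)
    qed
    then show "(G * G) $$ (i, i) = (\<Sum>k<n. complex_of_real ((cmod (G $$ (i, k)))\<^sup>2))"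
      using i by (auto simp: mult_mat_entry[OF G G] intro!: sum.cong simp del: of_real_power)
  qed
  finally have "(\<Sum>i<n. \<Sum>k<n. (cmod (G $$ (i, k)))\<^sup>2) = 0"
    by (simp only: of_real_sum[symmetric] of_real_eq_0_iff)
  then have "G $$ (i, k) = 0" if "i < n" "k < n" for i k
    using that by (simp add: sum_nonneg_eq_0_iff sum_nonneg)
  then have "G = 0\<^sub>m n n" using G by (intro eq_matI) auto
  with nz show False ..
qed

lemma adjoint_vec_entry:
  fixes A :: "complex mat"
  assumes "A \<in> carrier_mat n m" "w \<in> carrier_vec n" "i < m"
  shows "(mat_adjoint A *\<^sub>v w) $ i = w \<bullet>c col A i"
  using assms by (simp add: scalar_prod_def lessThan_atLeast0 conjugate_complex_def mult.commute)

definition diag_of :: "nat \<Rightarrow> (nat \<Rightarrow> complex) \<Rightarrow> complex mat" where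
  "diag_of n f = mat n n (\<lambda>(i, j). if i = j then f i else 0)"

lemma diag_of_carrier [simp]: "diag_of n f \<in> carrier_mat n n"
  by (simp add: diag_of_def)

lemma diag_of_index: "i < n \<Longrightarrow> j < n \<Longrightarrow> diag_of n f $$ (i, j) = (if i = j then f i else 0)"
  by (simp add: diag_of_def)

lemma mat_adjoint_diag_of: "mat_adjoint (diag_of n f) = diag_of n (\<lambda>i. cnj (f i))"
  by (rule eq_matI) (simp_all add: diag_of_def)

lemma mult_diag_of_entry:
  assumes "A \<in> carrier_mat n m" "i < n" "j < m"
  shows "(A * diag_of m f) $$ (i, j) = f j * A $$ (i, j)"
proof -
  have "(A * diag_of m f) $$ (i, j) = (\<Sum>k<m. A $$ (i, k) * diag_of m f $$ (k, j))"
    by (rule mult_mat_entry[OF assms(1) diag_of_carrier assms(2,3)])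
  also have "\<dots> = (\<Sum>k<m. if k = j then f j * A $$ (i, j) else 0)"
    using assms by (intro sum.cong) (auto simp: diag_of_index)
  finally show ?thesis using assms by simp
qed

lemma diag_of_mult: "diag_of n f * diag_of n g = diag_of n (\<lambda>i. f i * g i)"
proof (rule eq_matI)
  fix i j assume "i < dim_row (diag_of n (\<lambda>i. f i * g i))" "j < dim_col (diag_of n (\<lambda>i. f i * g i))"
  then have "i < n" "j < n" by (simp_all add: diag_of_def)
  then show "(diag_of n f * diag_of n g) $$ (i, j) = diag_of n (\<lambda>i. f i * g i) $$ (i, j)"
    by (simp add: mult_diag_of_entry[OF diag_of_carrier] diag_of_index del: index_mult_mat)
qed (simp_all add: diag_of_def)

lemma col_mult_diag_of:
  assumes "A \<in> carrier_mat n m" "j < m"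
  shows "col (A * diag_of m f) j = f j \<cdot>\<^sub>v col A j"
  using assms mult_diag_of_entry[OF assms(1)]
  by (intro eq_vecI) (simp_all add: diag_of_def del: index_mult_mat(1))

lemma adjoint_mult_orthonormal:
  fixes V :: "complex mat"
  assumes "V \<in> carrier_mat n k"
    and "\<And>i j. i < k \<Longrightarrow> j < k \<Longrightarrow> col V i \<bullet>c col V j = (if i = j then 1 else 0)"
  shows "mat_adjoint V * V = 1\<^sub>m k"
  using assms adjoint_mult_entry[OF assms(1) assms(1)] by (intro eq_matI) (simp_all del: index_mult_mat(1))

text \<open>Deflation: \<open>K = V L V\<^sup>*\<close>, with \<open>L\<close> the diagonal matrix of eigenvalues, is the part of \<open>H\<close> that the
columns of \<open>V\<close> account for, and \<open>G = H - K\<close> is Hermitian and kills these columns. An eigenvector of \<open>G\<close> for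
a nonzero eigenvalue is therefore orthogonal to the columns of \<open>V\<close>, and there \<open>H\<close> and \<open>G\<close> agree. If
\<open>G = 0\<close>, every vector orthogonal to the columns of \<open>V\<close> is an eigenvector of \<open>H\<close> for the eigenvalue \<open>0\<close>.\<close>

lemma extend_orthonormal_eigenvectors:
  fixes H V :: "complex mat"
  assumes H: "H \<in> carrier_mat n n" and herm: "mat_adjoint H = H"
    and V: "V \<in> carrier_mat n k" and k: "k < n"
    and iso: "mat_adjoint V * V = 1\<^sub>m k" and HV: "H * V = V * diag_of k f"
  shows "\<exists>w e. w \<in> carrier_vec n \<and> w \<bullet>c w = 1 \<and> mat_adjoint V *\<^sub>v w = 0\<^sub>v k \<and> H *\<^sub>v w = e \<cdot>\<^sub>v w"
proof -
  define L where "L = diag_of k f"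
  note c [simp] = H V mat_adjoint_carrier[OF V]
  have L [simp]: "L \<in> carrier_mat k k" by (simp add: L_def)
  have VH: "mat_adjoint V * H = mat_adjoint L * mat_adjoint V"
    using arg_cong[OF HV, of mat_adjoint] herm
    by (simp add: mat_adjoint_mult[OF H V] mat_adjoint_mult[OF V L] L_def[symmetric])
  \<comment> \<open>\<open>L\<close> equals the Hermitian matrix \<open>V\<^sup>* H V\<close>; so the eigenvalues in \<open>f\<close> are real.\<close>
  have "L = mat_adjoint V * (H * V)"
    using assoc_mult_mat[OF c(3) V L] iso L HV by (simp add: L_def[symmetric])
  also have "\<dots> = (mat_adjoint L * mat_adjoint V) * V"
    using assoc_mult_mat[OF c(3) H V] VH by simp
  also have "\<dots> = mat_adjoint L"
    using assoc_mult_mat[OF mat_adjoint_carrier[OF L] c(3) V] iso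
    right_mult_one_mat[OF mat_adjoint_carrier[OF L]] by simp
  finally have Lherm: "mat_adjoint L = L" by simp
  define K where "K = V * (L * mat_adjoint V)"
  have K [simp]: "K \<in> carrier_mat n n" by (simp add: K_def mult_carrier_mat[of _ _ k])
  have Kherm: "mat_adjoint K = K"
    unfolding K_def
    by (simp add: mat_adjoint_mult[OF V mult_carrier_mat[OF L c(3)]] mat_adjoint_mult[OF L c(3)]
        Lherm assoc_mult_mat[OF V L c(3)])
  have KV: "K * V = H * V"
    unfolding K_def HV
    by (simp add: assoc_mult_mat[OF V mult_carrier_mat[OF L c(3)] V] assoc_mult_mat[OF L c(3) V] iso
        L_def[symmetric] right_mult_one_mat[OF L])
  have K0: "K *\<^sub>v w = 0\<^sub>v n" if w: "w \<in> carrier_vec n" and "mat_adjoint V *\<^sub>v w = 0\<^sub>v k" for w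
  proof -
    have "K *\<^sub>v w = V *\<^sub>v (L *\<^sub>v (mat_adjoint V *\<^sub>v w))"
      unfolding K_def using assoc_mult_mat_vec[OF V mult_carrier_mat[OF L c(3)] w]
        assoc_mult_mat_vec[OF L c(3) w] by simp
    also have "\<dots> = 0\<^sub>v n"
    proof -
      have zero: "M *\<^sub>v 0\<^sub>v b = 0\<^sub>v a" if "M \<in> carrier_mat a b" for M :: "complex mat" and a b
        using that by (intro eq_vecI) auto
      show ?thesis unfolding that(2) by (simp only: zero[OF L] zero[OF V])
    qed
    finally show ?thesis .
  qed
  show ?thesis
  proof (cases "H = K")
    case True
    obtain w where w: "w \<in> carrier_vec n" "w \<bullet>c w = 1" "\<And>i. i < k \<Longrightarrow> w \<bullet>c col V i = 0"
      using exists_unit_orthogonal[of "{..<k}" "col V" n k] k col_carrier_vec[OF _ V] by auto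
    have "mat_adjoint V *\<^sub>v w = 0\<^sub>v k"
      using w carrier_matD[OF V]
      by (intro eq_vecI) (simp_all add: adjoint_vec_entry[OF V] del: index_mult_mat_vec)
    moreover from this have "H *\<^sub>v w = 0 \<cdot>\<^sub>v w" using True K0 w(1) by auto
    ultimately show ?thesis using w by blast
  next
    case False
    define G where "G = H - K"
    have G [simp]: "G \<in> carrier_mat n n" by (simp add: G_def minus_carrier_mat)
    have Gherm: "mat_adjoint G = G"
      by (simp add: G_def mat_adjoint_minus[OF H K] herm Kherm)
    have HG: "H = G + K" unfolding G_def using carrier_matD[OF H] carrier_matD[OF K] by (intro eq_matI) auto
    have "G \<noteq> 0\<^sub>m n n" using False HG by auto
    then obtain e w where e: "e \<noteq> 0" and w: "w \<in> carrier_vec n" "w \<noteq> 0\<^sub>v n" "G *\<^sub>v w = e \<cdot>\<^sub>v w"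
      using hermitian_nonzero_eigenvalue[OF G Gherm] by blast
    have "G * V = 0\<^sub>m n k"
      unfolding G_def using minus_mult_distrib_mat[OF H K V] KV mult_carrier_mat[OF H V] by simp
    then have "mat_adjoint V * G = mat_adjoint (0\<^sub>m n k)"
      using mat_adjoint_mult[OF G V] Gherm by simp
    also have "\<dots> = 0\<^sub>m k n" by (rule eq_matI) simp_all
    finally have VG: "mat_adjoint V * G = 0\<^sub>m k n" .
    have "e \<cdot>\<^sub>v (mat_adjoint V *\<^sub>v w) = mat_adjoint V *\<^sub>v (G *\<^sub>v w)"
      using w by (simp add: mult_mat_vec[OF c(3)])
    also have "\<dots> = 0\<^sub>m k n *\<^sub>v w"
      using assoc_mult_mat_vec[OF c(3) G w(1)] VG by simp
    also have "\<dots> = 0\<^sub>v k" using w(1) by (intro eq_vecI) auto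
    finally have "(e \<cdot>\<^sub>v (mat_adjoint V *\<^sub>v w)) $ i = 0" if "i < k" for i using that by simp
    then have Vw: "mat_adjoint V *\<^sub>v w = 0\<^sub>v k"
      using e carrier_matD[OF V] by (intro eq_vecI) simp_all
    have Hw: "H *\<^sub>v w = e \<cdot>\<^sub>v w"
      using add_mult_distrib_mat_vec[OF G K w(1)] K0[OF w(1) Vw] w by (simp add: HG[symmetric])
    obtain a where a: "(a \<cdot>\<^sub>v w) \<bullet>c (a \<cdot>\<^sub>v w) = 1" using normalise_vec[OF w(1,2)] by blast
    have "mat_adjoint V *\<^sub>v (a \<cdot>\<^sub>v w) = 0\<^sub>v k"
      using mult_mat_vec[OF c(3) w(1), of a] Vw by (intro eq_vecI) simp_all
    moreover have "H *\<^sub>v (a \<cdot>\<^sub>v w) = e \<cdot>\<^sub>v (a \<cdot>\<^sub>v w)"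
      using mult_mat_vec[OF H w(1)] Hw by (simp add: smult_smult_assoc mult.commute)
    ultimately show ?thesis using a w(1) by (intro exI[of _ "a \<cdot>\<^sub>v w"] exI[of _ e]) simp
  qed
qed

lemma orthonormal_eigenvectors:
  fixes H :: "complex mat"
  assumes H: "H \<in> carrier_mat n n" and herm: "mat_adjoint H = H" and "k \<le> n"
  shows "\<exists>V f. V \<in> carrier_mat n k \<and> mat_adjoint V * V = 1\<^sub>m k \<and> H * V = V * diag_of k f"
  using \<open>k \<le> n\<close>
proof (induction k)
  case 0
  show ?case by (intro exI[of _ "0\<^sub>m n 0"] exI) (use H in \<open>auto simp: diag_of_def\<close>)
next
  case (Suc k)
  then obtain V f where V: "V \<in> carrier_mat n k" and iso: "mat_adjoint V * V = 1\<^sub>m k"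
    and HV: "H * V = V * diag_of k f" by auto
  obtain w e where w: "w \<in> carrier_vec n" "w \<bullet>c w = 1" "mat_adjoint V *\<^sub>v w = 0\<^sub>v k" "H *\<^sub>v w = e \<cdot>\<^sub>v w"
    using extend_orthonormal_eigenvectors[OF H herm V _ iso HV] Suc.prems by auto
  define v where "v i = (if i < k then col V i else w)" for i
  define g where "g i = (if i < k then f i else e)" for i
  define V' where "V' = mat n (Suc k) (\<lambda>(a, i). v i $ a)"
  have v: "v i \<in> carrier_vec n" for i using V w by (simp add: v_def)
  have V': "V' \<in> carrier_mat n (Suc k)" by (simp add: V'_def)
  have colV': "col V' i = v i" if "i < Suc k" for i
    using that v[of i] by (intro eq_vecI) (auto simp: V'_def)
  have wV: "w \<bullet>c col V i = 0" if "i < k" for i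
    using adjoint_vec_entry[OF V w(1) that] w(3) that by simp
  have VV: "col V i \<bullet>c col V j = (if i = j then 1 else 0)" if "i < k" "j < k" for i j
    using adjoint_mult_entry[OF V V that(2,1)] iso that by (auto simp del: index_mult_mat)
  have Vw: "col V i \<bullet>c w = 0" if "i < k" for i
    using cscalar_commute[OF w(1) col_carrier_vec[OF that V]] wV[OF that] by simp
  have "mat_adjoint V' * V' = 1\<^sub>m (Suc k)"
  proof (rule adjoint_mult_orthonormal[OF V'])
    fix i j assume "i < Suc k" "j < Suc k"
    then show "col V' i \<bullet>c col V' j = (if i = j then 1 else 0)"
      using VV wV Vw w(2) by (auto simp: colV' v_def)
  qed
  moreover have "H * V' = V' * diag_of (Suc k) g"
  proof (rule mat_col_eqI)
    fix i assume "i < dim_col (V' * diag_of (Suc k) g)"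
    then have i: "i < Suc k" by (simp add: diag_of_def)
    have "col (H * V') i = H *\<^sub>v v i" using col_mult2[OF H V' i] colV'[OF i] by simp
    also have "\<dots> = g i \<cdot>\<^sub>v v i"
    proof (cases "i < k")
      case True
      then show ?thesis
        using col_mult2[OF H V True] col_mult_diag_of[OF V True, of f] HV by (simp add: v_def g_def)
    qed (use w in \<open>simp add: v_def g_def\<close>)
    also have "\<dots> = col (V' * diag_of (Suc k) g) i"
      using col_mult_diag_of[OF V' i, of g] colV'[OF i] by simp
    finally show "col (H * V') i = col (V' * diag_of (Suc k) g) i" .
  qed (use H V' in \<open>simp_all add: diag_of_def\<close>)
  ultimately show ?case using V' by blast
qed

lemma hermitian_spectral:
  fixes H :: "complex mat"
  assumes H: "H \<in> carrier_mat n n" and herm: "mat_adjoint H = H"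
  shows "\<exists>V f. V \<in> carrier_mat n n \<and> mat_adjoint V * V = 1\<^sub>m n \<and> V * mat_adjoint V = 1\<^sub>m n \<and>
    H * V = V * diag_of n f \<and> H = V * diag_of n f * mat_adjoint V"
proof -
  obtain V f where V: "V \<in> carrier_mat n n" and iso: "mat_adjoint V * V = 1\<^sub>m n"
    and HV: "H * V = V * diag_of n f"
    using orthonormal_eigenvectors[OF H herm order_refl] by blast
  have VV: "V * mat_adjoint V = 1\<^sub>m n"
    by (rule mat_mult_left_right_inverse[OF _ V iso]) (use V in simp)
  have "V * diag_of n f * mat_adjoint V = H * (V * mat_adjoint V)"
    unfolding HV[symmetric] by (rule assoc_mult_mat[OF H V mat_adjoint_carrier[OF V]])
  then have "H = V * diag_of n f * mat_adjoint V" using VV H by simp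
  then show ?thesis using V iso VV HV by blast
qed

section \<open>Square roots of positive semidefinite matrices\<close>

lemma positive_semidefinite_gram:
  assumes T: "T \<in> carrier_mat m n"
  shows "positive_semidefinite (mat_adjoint T * T)"
proof -
  note T' = mat_adjoint_carrier[OF T]
  have "0 \<le> ((mat_adjoint T * T) *\<^sub>v v) \<bullet>c v" if v: "v \<in> carrier_vec n" for v
  proof -
    have Tv: "T *\<^sub>v v \<in> carrier_vec m" using T v by simp
    have "((mat_adjoint T * T) *\<^sub>v v) \<bullet>c v = (T *\<^sub>v v) \<bullet>c (T *\<^sub>v v)"
      using cscalar_adjoint[OF T' Tv v] assoc_mult_mat_vec[OF T' T v] by simp
    then show ?thesis using conjugate_square_ge_0_vec[of "T *\<^sub>v v"] by simp
  qed
  then show ?thesis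
    using T mat_adjoint_mult[OF T' T] by (simp add: positive_semidefinite_def square_mat.simps)
qed

lemma diag_of_cong: "(\<And>i. i < n \<Longrightarrow> f i = g i) \<Longrightarrow> diag_of n f = diag_of n g"
  by (rule eq_matI) (simp_all add: diag_of_def)

lemma psd_root_exists:
  assumes M: "M \<in> carrier_mat n n" and psd: "positive_semidefinite M"
  shows "\<exists>P \<in> carrier_mat n n. positive_semidefinite P \<and> P * P = M"
proof -
  have herm: "mat_adjoint M = M" using psd by (simp add: positive_semidefinite_def)
  obtain V f where V: "V \<in> carrier_mat n n" and iso: "mat_adjoint V * V = 1\<^sub>m n"
    and MV: "M * V = V * diag_of n f" and dec: "M = V * diag_of n f * mat_adjoint V"
    using hermitian_spectral[OF M herm] by blast
  have f: "0 \<le> f i" if i: "i < n" for i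
  proof -
    let ?v = "col V i"
    have v: "?v \<in> carrier_vec n" using i V by simp
    have "?v \<bullet>c ?v = 1" using adjoint_mult_entry[OF V V i i] iso i by simp
    moreover have "M *\<^sub>v ?v = f i \<cdot>\<^sub>v ?v"
      using col_mult2[OF M V i] col_mult_diag_of[OF V i, of f] MV by simp
    ultimately have "(M *\<^sub>v ?v) \<bullet>c ?v = f i" using v by simp
    then show ?thesis using psd M v unfolding positive_semidefinite_def by force
  qed
  define s where "s i = sqrt (Re (f i))" for i
  \<comment> \<open>Fourth roots of the eigenvalues: they exhibit the square root as \<open>T\<^sup>* T\<close>, which makes its
    positivity immediate.\<close>
  define t where "t = diag_of n (\<lambda>i. complex_of_real (sqrt (s i)))"
  define T where "T = t * mat_adjoint V"
  define S where "S = diag_of n (\<lambda>i. complex_of_real (s i))"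
  note V' = mat_adjoint_carrier[OF V]
  note assoc = assoc_mult_mat[of _ n n _ n _ n] and closed = mult_carrier_mat[of _ n n _ n]
  have t: "t \<in> carrier_mat n n" by (simp add: t_def)
  have T: "T \<in> carrier_mat n n" using V' t by (simp add: T_def closed)
  have s0: "0 \<le> s i" if "i < n" for i using f[OF that] by (simp add: s_def less_eq_complex_def)
  have tt: "t * t = S"
    unfolding t_def diag_of_mult S_def
    by (rule diag_of_cong) (simp add: s0 flip: of_real_mult)
  have "mat_adjoint T = V * t"
    unfolding T_def mat_adjoint_mult[OF t V'] by (simp add: t_def mat_adjoint_diag_of)
  then have "mat_adjoint T * T = V * ((t * t) * mat_adjoint V)"
    using V V' t by (simp add: T_def closed assoc del: assoc_mult_mat)
  then have TT: "mat_adjoint T * T = V * (S * mat_adjoint V)" unfolding tt .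
  have S: "S \<in> carrier_mat n n" by (simp add: S_def)
  have SS: "S * S = diag_of n f"
    unfolding S_def diag_of_mult
  proof (rule diag_of_cong)
    fix i assume "i < n"
    then have "f i = complex_of_real (Re (f i))" "0 \<le> Re (f i)"
      using f[of i] by (simp_all add: less_eq_complex_def complex_eq_iff)
    then show "complex_of_real (s i) * complex_of_real (s i) = f i"
      by (simp add: s_def flip: of_real_mult)
  qed
  have "mat_adjoint T * T * (mat_adjoint T * T) = V * (S * ((mat_adjoint V * V) * (S * mat_adjoint V)))"
    unfolding TT using V V' S by (simp add: assoc closed del: assoc_mult_mat)
  also have "\<dots> = V * ((S * S) * mat_adjoint V)"
    unfolding iso using V V' S by (simp add: assoc closed del: assoc_mult_mat)
  also have "\<dots> = M" unfolding SS using V V' dec by (simp add: assoc closed del: assoc_mult_mat)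
  finally show ?thesis
    using positive_semidefinite_gram[OF T] closed[OF mat_adjoint_carrier[OF T] T] by blast
qed

text \<open>Let \<open>v\<close> be a unit eigenvector of \<open>P - Q\<close>, with eigenvalue \<open>p - q\<close>, where \<open>p\<close> and \<open>q\<close> are the values
at \<open>v\<close> of the quadratic forms of \<open>P\<close> and \<open>Q\<close>. As \<open>P * P = Q * Q\<close>, the vectors \<open>a = P v\<close> and \<open>b = Q v\<close> have the same norm;
expanding this with \<open>a = b + (p - q) v\<close> gives \<open>(p - q) (p + q) = 0\<close>, and so \<open>p = q\<close> because both are
nonnegative. Hence all eigenvalues of the Hermitian matrix \<open>P - Q\<close> are zero.\<close>

lemma psd_root_unique:
  assumes P: "P \<in> carrier_mat n n" "positive_semidefinite P"
    and Q: "Q \<in> carrier_mat n n" "positive_semidefinite Q" and eq: "P * P = Q * Q"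
  shows "P = Q"
proof -
  have herm: "mat_adjoint P = P" "mat_adjoint Q = Q"
    using P(2) Q(2) by (simp_all add: positive_semidefinite_def)
  define D where "D = P - Q"
  have D: "D \<in> carrier_mat n n" using P Q by (simp add: D_def minus_carrier_mat)
  have "mat_adjoint D = D" using mat_adjoint_minus[OF P(1) Q(1)] herm by (simp add: D_def)
  then obtain V f where V: "V \<in> carrier_mat n n" and iso: "mat_adjoint V * V = 1\<^sub>m n"
    and DV: "D * V = V * diag_of n f" and dec: "D = V * diag_of n f * mat_adjoint V"
    using hermitian_spectral[OF D] by blast
  have f0: "f i = 0" if i: "i < n" for i
  proof -
    define v where "v = col V i"
    have v: "v \<in> carrier_vec n" using i V by (simp add: v_def)
    have one: "v \<bullet>c v = 1" using adjoint_mult_entry[OF V V i i] iso i by (simp add: v_def)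
    have Dv: "D *\<^sub>v v = f i \<cdot>\<^sub>v v"
      using col_mult2[OF D V i] col_mult_diag_of[OF V i, of f] DV by (simp add: v_def)
    define a b where "a = P *\<^sub>v v" and "b = Q *\<^sub>v v"
    have a: "a \<in> carrier_vec n" and b: "b \<in> carrier_vec n"
      unfolding a_def b_def using P Q v by (auto intro: mult_mat_vec_carrier)
    have "a - b = f i \<cdot>\<^sub>v v"
      unfolding Dv[symmetric] unfolding D_def a_def b_def
      using minus_mult_distrib_mat_vec[OF P(1) Q(1) v] by simp
    moreover have "a = b + (a - b)" using a b by (intro eq_vecI) auto
    ultimately have ab: "a = b + f i \<cdot>\<^sub>v v" by simp
    have p0: "0 \<le> a \<bullet>c v" and q0: "0 \<le> b \<bullet>c v"
      using P Q v unfolding positive_semidefinite_def a_def b_def by auto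
    have "a \<bullet>c a = (P *\<^sub>v a) \<bullet>c v" "b \<bullet>c b = (Q *\<^sub>v b) \<bullet>c v"
      using cscalar_adjoint[OF P(1) a v] cscalar_adjoint[OF Q(1) b v] herm by (simp_all add: a_def b_def)
    moreover have "P *\<^sub>v a = Q *\<^sub>v b"
      unfolding a_def b_def using assoc_mult_mat_vec[OF P(1) P(1) v] assoc_mult_mat_vec[OF Q(1) Q(1) v] eq by simp
    ultimately have norm: "a \<bullet>c a = b \<bullet>c b" by simp
    have "a \<bullet>c a = a \<bullet>c b + cnj (f i) * (a \<bullet>c v)"
      using a b v by (subst (2) ab) (simp add: conjugate_add_vec[of _ n] conjugate_smult_vec scalar_prod_add_distrib[of _ n] conjugate_complex_def)
    moreover have "a \<bullet>c b = b \<bullet>c b + f i * (v \<bullet>c b)"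
      using a b v by (subst (1) ab) (simp add: add_scalar_prod_distrib[of _ n])
    moreover have "v \<bullet>c b = cnj (b \<bullet>c v)" by (rule cscalar_commute[OF b v])
    moreover have "a \<bullet>c v = b \<bullet>c v + f i"
      using a b v one by (subst (1) ab) (simp add: add_scalar_prod_distrib[of _ n])
    ultimately have "cnj (f i) * (a \<bullet>c v) + f i * cnj (b \<bullet>c v) = 0" and fi: "f i = a \<bullet>c v - b \<bullet>c v"
      using norm by (simp_all add: add.commute)
    moreover obtain p q where pq: "a \<bullet>c v = complex_of_real p" "b \<bullet>c v = complex_of_real q" "p \<ge> 0" "q \<ge> 0"
      using p0 q0 by (metis complex_is_Real_iff less_eq_complex_def of_real_Re zero_complex.sel)
    ultimately have "complex_of_real ((p - q) * p + (p - q) * q) = 0" by simp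
    then have "(p - q) * p + (p - q) * q = 0" by (simp only: of_real_eq_0_iff)
    then have "p ^ 2 = q ^ 2" by (simp add: algebra_simps power2_eq_square)
    then have "p = q" using pq by simp
    then show "f i = 0" using fi pq by simp
  qed
  have "diag_of n f = 0\<^sub>m n n" using f0 by (intro eq_matI) (simp_all add: diag_of_def)
  then have D0: "D = 0\<^sub>m n n" using dec V by simp
  show ?thesis
  proof (rule eq_matI)
    fix i j assume "i < dim_row Q" "j < dim_col Q"
    then show "P $$ (i, j) = Q $$ (i, j)" using arg_cong[OF D0, of "\<lambda>X. X $$ (i, j)"] P Q by (simp add: D_def)
  qed (use P Q in simp_all)
qed

lemma mat_abs_properties:
  assumes A: "A \<in> carrier_mat d d'"
  shows "mat_abs A \<in> carrier_mat d' d'" "mat_adjoint (mat_abs A) = mat_abs A"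
    "mat_abs A * mat_abs A = mat_adjoint A * A"
proof -
  let ?M = "mat_adjoint A * A"
  have M: "?M \<in> carrier_mat d' d'" using A by (simp add: mult_carrier_mat[of _ _ d])
  have "\<exists>!P. P \<in> carrier_mat d' d' \<and> positive_semidefinite P \<and> P * P = ?M"
    using psd_root_exists[OF M positive_semidefinite_gram[OF A]] psd_root_unique by (metis (no_types))
  from theI'[OF this] A
  have "mat_abs A \<in> carrier_mat d' d' \<and> positive_semidefinite (mat_abs A) \<and> mat_abs A * mat_abs A = ?M"
    by (simp add: mat_abs_def psd_sqrt_def)
  then show "mat_abs A \<in> carrier_mat d' d'" "mat_adjoint (mat_abs A) = mat_abs A"
    "mat_abs A * mat_abs A = mat_adjoint A * A" by (auto simp: positive_semidefinite_def)
qed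

lemma mat_abs_pow2:
  assumes "A \<in> carrier_mat d d'"
  shows "mat_abs A ^\<^sub>m 2 = mat_adjoint A * A"
  using mat_abs_properties[OF assms] by (simp add: numeral_2_eq_2)

section \<open>Exchanging the two Gram matrices of a tall matrix\<close>

text \<open>The members are normalised one by one. A zero vector is replaced by a unit vector orthogonal to all the
other members, with coefficient \<open>0\<close>; the bound \<open>m \<le> d\<close> leaves room for it.\<close>

lemma orthogonal_family_normalised:
  fixes x :: "nat \<Rightarrow> complex vec"
  assumes x: "\<And>i. i < m \<Longrightarrow> x i \<in> carrier_vec d" and "m \<le> d"
    and ort: "\<And>i j. i < m \<Longrightarrow> j < m \<Longrightarrow> i \<noteq> j \<Longrightarrow> x i \<bullet>c x j = 0" and "k \<le> m"
  shows "\<exists>y c. (\<forall>i<m. y i \<in> carrier_vec d \<and> x i = c i \<cdot>\<^sub>v y i) \<and>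
    (\<forall>i<m. \<forall>j<m. i \<noteq> j \<longrightarrow> y i \<bullet>c y j = 0) \<and> (\<forall>i<k. y i \<bullet>c y i = 1)"
  using \<open>k \<le> m\<close>
proof (induction k)
  case 0
  show ?case by (intro exI[of _ x] exI[of _ "\<lambda>_. 1"]) (use x ort in auto)
next
  case (Suc k)
  from Suc.IH[OF Suc_leD[OF Suc.prems]] obtain y c where IH: "\<forall>i<m. y i \<in> carrier_vec d \<and> x i = c i \<cdot>\<^sub>v y i"
      "\<forall>i<m. \<forall>j<m. i \<noteq> j \<longrightarrow> y i \<bullet>c y j = 0" "\<forall>i<k. y i \<bullet>c y i = 1"
    by (elim exE conjE)
  from IH have y: "\<And>i. i < m \<Longrightarrow> y i \<in> carrier_vec d"
    and xy: "\<And>i. i < m \<Longrightarrow> x i = c i \<cdot>\<^sub>v y i"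
    and yort: "\<And>i j. i < m \<Longrightarrow> j < m \<Longrightarrow> i \<noteq> j \<Longrightarrow> y i \<bullet>c y j = 0"
    and unit: "\<And>i. i < k \<Longrightarrow> y i \<bullet>c y i = 1" by blast+
  have k: "k < m" using Suc.prems by simp
  obtain w a where w: "w \<in> carrier_vec d" "w \<bullet>c w = 1" "x k = a \<cdot>\<^sub>v w"
    and wy: "\<And>j. j < m \<Longrightarrow> j \<noteq> k \<Longrightarrow> w \<bullet>c y j = 0"
  proof (cases "y k = 0\<^sub>v d")
    case True
    have "k < d" "{..<m} - {k} \<subseteq> {..<d}" using k \<open>m \<le> d\<close> by auto
    then obtain w where w: "w \<in> carrier_vec d" "w \<bullet>c w = 1" "\<forall>j\<in>{..<m} - {k}. w \<bullet>c y j = 0"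
      using exists_unit_orthogonal[of "{..<m} - {k}" y d k] y by blast
    have "x k = 0 \<cdot>\<^sub>v w" using xy[OF k] True w(1) by auto
    then show ?thesis by (rule that[OF w(1,2)]) (use w(3) in auto)
  next
    case False
    obtain b where b: "b \<noteq> 0" "(b \<cdot>\<^sub>v y k) \<bullet>c (b \<cdot>\<^sub>v y k) = 1" using normalise_vec[OF y[OF k] False] by blast
    show ?thesis
    proof (rule that[of "b \<cdot>\<^sub>v y k" "c k / b"])
      fix j assume "j < m" "j \<noteq> k"
      then show "(b \<cdot>\<^sub>v y k) \<bullet>c y j = 0" using y[OF k] y[of j] yort[of k j] k by simp
    qed (use b xy y k in \<open>simp_all add: smult_smult_assoc\<close>)
  qed
  have yw: "y j \<bullet>c w = 0" if "j < m" "j \<noteq> k" for j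
    using cscalar_commute[OF w(1) y[OF that(1)]] wy[OF that] by simp
  show ?case
  proof (intro exI[of _ "y(k := w)"] exI[of _ "c(k := a)"] conjI allI impI)
    fix i j assume "i < m" "j < m" "i \<noteq> j"
    then show "(y(k := w)) i \<bullet>c (y(k := w)) j = 0" using yort wy yw by auto
  qed (use w y xy unit less_Suc_eq in auto)
qed

text \<open>This is what the polar decomposition \<open>N = U |N|\<close> gives. It is obtained from a diagonalisation
\<open>V\<close> of \<open>N\<^sup>* N\<close>: the columns of \<open>X = N V\<close> are orthogonal, so \<open>X = W E\<close> with \<open>W\<close> an isometry
and \<open>E\<close> diagonal. Now \<open>E\<close> and \<open>E\<^sup>*\<close> commute, and \<open>U = W V\<^sup>*\<close> works.\<close>

lemma isometry_swaps_gram: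
  assumes N: "N \<in> carrier_mat d m" and md: "m \<le> d"
  shows "\<exists>U \<in> carrier_mat d m. isometry_mat U \<and>
    N * mat_adjoint N = U * (mat_adjoint N * N) * mat_adjoint U"
proof -
  define K where "K = mat_adjoint N * N"
  note N' = mat_adjoint_carrier[OF N]
  have K: "K \<in> carrier_mat m m" using N by (simp add: K_def mult_carrier_mat[of _ _ d])
  have "mat_adjoint K = K" unfolding K_def using mat_adjoint_mult[OF N' N] by simp
  then obtain V f where V: "V \<in> carrier_mat m m" and iso: "mat_adjoint V * V = 1\<^sub>m m"
    and VV: "V * mat_adjoint V = 1\<^sub>m m" and KV: "K * V = V * diag_of m f"
    using hermitian_spectral[OF K] by blast
  note V' = mat_adjoint_carrier[OF V]
  define X where "X = N * V"
  have X: "X \<in> carrier_mat d m" using N V by (simp add: X_def mult_carrier_mat[of _ _ m])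
  note X' = mat_adjoint_carrier[OF X]
  note rules = assoc_mult_mat[of _ d m _ m _ d] assoc_mult_mat[of _ d m _ m _ m] assoc_mult_mat[of _ m d _ m _ m]
    assoc_mult_mat[of _ m m _ d _ m] assoc_mult_mat[of _ m m _ m _ m] assoc_mult_mat[of _ m m _ m _ d]
    mult_carrier_mat[of _ d m _ m] mult_carrier_mat[of _ m m _ m] mult_carrier_mat[of _ m m _ d]
    mult_carrier_mat[of _ m d _ m]
  have XX: "mat_adjoint X * X = mat_adjoint V * (K * V)"
    unfolding X_def K_def mat_adjoint_mult[OF N V] using N V N' V' by (simp add: rules del: assoc_mult_mat)
  also have "\<dots> = (mat_adjoint V * V) * diag_of m f"
    unfolding KV using V V' by (simp add: rules del: assoc_mult_mat)
  also have "\<dots> = diag_of m f" unfolding iso using diag_of_carrier by (rule left_mult_one_mat)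
  finally have XXf: "mat_adjoint X * X = diag_of m f" .
  have ort: "col X i \<bullet>c col X j = 0" if "i < m" "j < m" "i \<noteq> j" for i j
    using adjoint_mult_entry[OF X X that(2,1)] that XXf by (simp add: diag_of_index del: index_mult_mat)
  have "\<exists>y c. (\<forall>i<m. y i \<in> carrier_vec d \<and> col X i = c i \<cdot>\<^sub>v y i) \<and>
      (\<forall>i<m. \<forall>j<m. i \<noteq> j \<longrightarrow> y i \<bullet>c y j = 0) \<and> (\<forall>i<m. y i \<bullet>c y i = 1)"
    by (rule orthogonal_family_normalised[OF _ md ort order_refl]) (use X in auto)
  then obtain y c where F: "\<forall>i<m. y i \<in> carrier_vec d \<and> col X i = c i \<cdot>\<^sub>v y i"
      "\<forall>i<m. \<forall>j<m. i \<noteq> j \<longrightarrow> y i \<bullet>c y j = 0" "\<forall>i<m. y i \<bullet>c y i = 1"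
    by (elim exE conjE)
  from F have y: "\<And>i. i < m \<Longrightarrow> y i \<in> carrier_vec d" "\<And>i. i < m \<Longrightarrow> col X i = c i \<cdot>\<^sub>v y i"
    and yort: "\<And>i j. i < m \<Longrightarrow> j < m \<Longrightarrow> i \<noteq> j \<Longrightarrow> y i \<bullet>c y j = 0" "\<And>i. i < m \<Longrightarrow> y i \<bullet>c y i = 1"
    by blast+
  define W where "W = mat d m (\<lambda>(a, i). y i $ a)"
  define E where "E = diag_of m c"
  have W: "W \<in> carrier_mat d m" and E: "E \<in> carrier_mat m m" by (simp_all add: W_def E_def)
  note W' = mat_adjoint_carrier[OF W] and E' = mat_adjoint_carrier[OF E]
  have colW: "col W i = y i" if "i < m" for i
    using that y(1)[OF that] by (intro eq_vecI) (simp_all add: W_def)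
  have WW: "mat_adjoint W * W = 1\<^sub>m m"
    by (rule adjoint_mult_orthonormal[OF W]) (simp add: colW yort)
  have XWE: "X = W * E"
  proof (rule mat_col_eqI)
    fix i assume "i < dim_col (W * E)"
    then have "i < m" using E by simp
    then show "col X i = col (W * E) i" using col_mult_diag_of[OF W, of i c] y colW by (simp add: E_def)
  qed (use X W E in simp_all)
  have EE: "mat_adjoint X * X = mat_adjoint E * E"
  proof -
    have "mat_adjoint X * X = mat_adjoint E * ((mat_adjoint W * W) * E)"
      unfolding XWE mat_adjoint_mult[OF W E] using W E W' E' by (simp add: rules del: assoc_mult_mat)
    then show ?thesis unfolding WW left_mult_one_mat[OF E] .
  qed
  have comm: "E * mat_adjoint E = mat_adjoint E * E"
    by (simp add: E_def mat_adjoint_diag_of diag_of_mult mult.commute)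
  define U where "U = W * mat_adjoint V"
  have U: "U \<in> carrier_mat d m" using W V' by (simp add: U_def rules)
  have adjU: "mat_adjoint U = V * mat_adjoint W" unfolding U_def mat_adjoint_mult[OF W V'] by simp
  have "mat_adjoint U * U = V * ((mat_adjoint W * W) * mat_adjoint V)"
    unfolding adjU unfolding U_def using W W' V V' by (simp add: rules del: assoc_mult_mat)
  also have "\<dots> = 1\<^sub>m m" unfolding WW left_mult_one_mat[OF V'] by (rule VV)
  finally have isoU: "isometry_mat U" using U md by (simp add: isometry_mat_def)
  have "N * mat_adjoint N = N * ((V * mat_adjoint V) * mat_adjoint N)"
    unfolding VV left_mult_one_mat[OF N'] ..
  also have "\<dots> = X * mat_adjoint X"
    unfolding X_def mat_adjoint_mult[OF N V] using N V N' V' by (simp add: rules del: assoc_mult_mat)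
  also have "\<dots> = W * ((E * mat_adjoint E) * mat_adjoint W)"
    unfolding XWE mat_adjoint_mult[OF W E] using W E W' E' by (simp add: rules del: assoc_mult_mat)
  also have "E * mat_adjoint E = mat_adjoint V * (K * V)"
    unfolding comm EE[symmetric] by (rule XX)
  also have "W * (mat_adjoint V * (K * V) * mat_adjoint W) = U * K * mat_adjoint U"
    unfolding adjU unfolding U_def using K V V' W W' by (simp add: rules del: assoc_mult_mat)
  finally show ?thesis using U isoU unfolding K_def by blast
qed

section \<open>Submatrices and Gram matrices\<close>

lemma finsum_ring_mat:
  fixes F :: "'k \<Rightarrow> complex mat"
  assumes "finite K" "\<And>k. k \<in> K \<Longrightarrow> F k \<in> carrier_mat n n"
  shows "(\<Oplus>\<^bsub>ring_mat TYPE(complex) n ()\<^esub> k\<in>K. F k) \<in> carrier_mat n n"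
    and "i < n \<Longrightarrow> j < n \<Longrightarrow>
      (\<Oplus>\<^bsub>ring_mat TYPE(complex) n ()\<^esub> k\<in>K. F k) $$ (i, j) = (\<Sum>k\<in>K. F k $$ (i, j))"
proof -
  interpret ring "ring_mat TYPE(complex) n ()" by (rule ring_mat)
  let ?S = "finsum (ring_mat TYPE(complex) n ()) F"
  have "?S K \<in> carrier_mat n n \<and> (i < n \<longrightarrow> j < n \<longrightarrow> ?S K $$ (i, j) = (\<Sum>k\<in>K. F k $$ (i, j)))"
    using assms
  proof (induction K rule: finite_induct)
    case empty
    then show ?case by (simp add: ring_mat_simps)
  next
    case (insert k K)
    have "?S (insert k K) = F k + ?S K"
      using insert by (subst finsum_insert) (auto simp: ring_mat_simps)
    then show ?case using insert by auto
  qed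
  then show "?S K \<in> carrier_mat n n"
    "i < n \<Longrightarrow> j < n \<Longrightarrow> ?S K $$ (i, j) = (\<Sum>k\<in>K. F k $$ (i, j))" by blast+
qed

lemma sum_pick:
  assumes "finite C"
  shows "(\<Sum>a<card C. g (pick C a)) = sum g C"
proof (rule sum.reindex_bij_betw)
  have "inj_on (pick C) {..<card C}"
    by (rule linorder_inj_onI) (use pick_mono_le in \<open>force+\<close>)
  moreover have "pick C ` {..<card C} \<subseteq> C" using pick_in_set_le by auto
  ultimately show "bij_betw (pick C) {..<card C} C"
    using assms by (simp add: bij_betw_def card_image card_subset_eq)
qed

lemma pick_less: "C \<subseteq> {..<n} \<Longrightarrow> a < card C \<Longrightarrow> pick C a < n"
  using pick_in_set_le[of a C] by auto

lemma submatrix_within: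
  assumes A: "A \<in> carrier_mat d d'" and P: "P \<subseteq> {..<d}" and C: "C \<subseteq> {..<d'}"
  shows "submatrix A P C \<in> carrier_mat (card P) (card C)"
    and "\<And>a b. a < card P \<Longrightarrow> b < card C \<Longrightarrow> submatrix A P C $$ (a, b) = A $$ (pick P a, pick C b)"
proof -
  have "{i. i < dim_row A \<and> i \<in> P} = P" "{j. j < dim_col A \<and> j \<in> C} = C" using assms by auto
  then show "submatrix A P C \<in> carrier_mat (card P) (card C)"
    "\<And>a b. a < card P \<Longrightarrow> b < card C \<Longrightarrow> submatrix A P C $$ (a, b) = A $$ (pick P a, pick C b)"
    by (simp_all add: submatrix_def)
qed

text \<open>For the strip \<open>S\<close> of the rows of \<open>A\<close> in \<open>P\<close> this is \<open>S\<^sup>* S\<close>. Written as a sum over \<open>P\<close>, it is visibly additive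
in \<open>P\<close>, and its size does not depend on \<open>P\<close>.\<close>

definition row_gram :: "complex mat \<Rightarrow> nat set \<Rightarrow> complex mat" where
  "row_gram A P = mat (dim_col A) (dim_col A) (\<lambda>(i, j). \<Sum>p\<in>P. cnj (A $$ (p, i)) * A $$ (p, j))"

lemma row_gram_carrier: "A \<in> carrier_mat d d' \<Longrightarrow> row_gram A P \<in> carrier_mat d' d'"
  by (simp add: row_gram_def)

lemma row_gram_index:
  "A \<in> carrier_mat d d' \<Longrightarrow> i < d' \<Longrightarrow> j < d' \<Longrightarrow>
    row_gram A P $$ (i, j) = (\<Sum>p\<in>P. cnj (A $$ (p, i)) * A $$ (p, j))"
  by (simp add: row_gram_def)

lemma gram_entry:
  assumes A: "A \<in> carrier_mat d d'" and ij: "i < d'" "j < d'"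
  shows "(mat_adjoint A * A) $$ (i, j) = (\<Sum>p<d. cnj (A $$ (p, i)) * A $$ (p, j))"
proof -
  have "(mat_adjoint A * A) $$ (i, j) = (\<Sum>p<d. mat_adjoint A $$ (i, p) * A $$ (p, j))"
    by (rule mult_mat_entry[OF mat_adjoint_carrier[OF A] A ij])
  also have "\<dots> = (\<Sum>p<d. cnj (A $$ (p, i)) * A $$ (p, j))"
    using A ij by (intro sum.cong) auto
  finally show ?thesis .
qed

lemma gram_eq_row_gram:
  assumes "A \<in> carrier_mat d d'"
  shows "mat_adjoint A * A = row_gram A {..<d}"
  by (rule eq_matI) (use assms in \<open>simp_all add: gram_entry row_gram_def del: index_mult_mat(1)\<close>)

text \<open>Restricting the columns of a strip restricts its Gram matrix to a principal block.\<close>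

lemma gram_submatrix:
  assumes A: "A \<in> carrier_mat d d'" and P: "P \<subseteq> {..<d}" and C: "C \<subseteq> {..<d'}"
  shows "mat_adjoint (submatrix A P C) * submatrix A P C = submatrix (row_gram A P) C C"
proof (rule eq_matI)
  note S = submatrix_within[OF A P C] and T = submatrix_within[OF row_gram_carrier[OF A] C C]
  fix i j assume "i < dim_row (submatrix (row_gram A P) C C)" "j < dim_col (submatrix (row_gram A P) C C)"
  with T(1)[of P] have ij: "i < card C" "j < card C" by auto
  have "(mat_adjoint (submatrix A P C) * submatrix A P C) $$ (i, j) =
      (\<Sum>a<card P. cnj (A $$ (pick P a, pick C i)) * A $$ (pick P a, pick C j))"
    unfolding gram_entry[OF S(1) ij] using S(2) ij by (intro sum.cong) auto
  also have "\<dots> = (\<Sum>p\<in>P. cnj (A $$ (p, pick C i)) * A $$ (p, pick C j))"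
    using sum_pick[of P "\<lambda>p. cnj (A $$ (p, pick C i)) * A $$ (p, pick C j)"] P finite_subset by blast
  also have "\<dots> = submatrix (row_gram A P) C C $$ (i, j)"
    using T(2)[OF ij] row_gram_index[OF A pick_less[OF C ij(1)] pick_less[OF C ij(2)]] by simp
  finally show "(mat_adjoint (submatrix A P C) * submatrix A P C) $$ (i, j) =
      submatrix (row_gram A P) C C $$ (i, j)" .
qed (use carrier_matD[OF submatrix_within(1)[OF A P C]]
    carrier_matD[OF submatrix_within(1)[OF row_gram_carrier[OF A, of P] C C]] in simp_all)

section \<open>Decomposition of a square into its principal blocks\<close>

text \<open>Added over a partition of the indices into sets \<open>C\<close>, the right-hand sides give \<open>M * M\<close>. So isometries with
this property express \<open>M * M\<close> through its principal blocks. The condition is stated for entries,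
since the sums it enters are regrouped entry by entry.\<close>

definition block_isometry :: "complex mat \<Rightarrow> nat set \<Rightarrow> complex mat \<Rightarrow> bool" where
  "block_isometry M C U \<longleftrightarrow> U \<in> carrier_mat (dim_row M) (card C) \<and> isometry_mat U \<and>
    (\<forall>i < dim_row M. \<forall>j < dim_row M.
      (U * submatrix (M * M) C C * mat_adjoint U) $$ (i, j) = (\<Sum>q\<in>C. M $$ (i, q) * M $$ (q, j)))"

lemma block_isometryD:
  assumes "block_isometry M C U" "M \<in> carrier_mat n n"
  shows "U \<in> carrier_mat n (card C)" "isometry_mat U"
    and "i < n \<Longrightarrow> j < n \<Longrightarrow>
      (U * submatrix (M * M) C C * mat_adjoint U) $$ (i, j) = (\<Sum>q\<in>C. M $$ (i, q) * M $$ (q, j))"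
  using assms unfolding block_isometry_def by simp_all

text \<open>With \<open>N\<close> the columns of \<open>M\<close> in \<open>C\<close>, the principal block is \<open>N\<^sup>* N\<close> and the sum over \<open>C\<close> is an entry of
\<open>N N\<^sup>*\<close>, as \<open>M\<close> is Hermitian.\<close>

lemma block_isometry_exists:
  fixes M :: "complex mat"
  assumes M: "M \<in> carrier_mat n n" and herm: "mat_adjoint M = M" and C: "C \<subseteq> {..<n}"
  shows "\<exists>U. block_isometry M C U"
proof -
  have fin: "finite C" using C finite_subset by blast
  have cardC: "card C \<le> n" using card_mono[OF _ C] by simp
  define N where "N = mat n (card C) (\<lambda>(i, a). M $$ (i, pick C a))"
  have N: "N \<in> carrier_mat n (card C)" by (simp add: N_def)
  have cnjM: "cnj (M $$ (i, j)) = M $$ (j, i)" if "i < n" "j < n" for i j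
    using mat_adjoint_index[of j M i] herm M that by simp
  have MM: "M * M \<in> carrier_mat n n" using M by simp
  note T = submatrix_within[OF MM C C]
  have "mat_adjoint N * N = submatrix (M * M) C C"
  proof (rule eq_matI)
    fix a b assume "a < dim_row (submatrix (M * M) C C)" "b < dim_col (submatrix (M * M) C C)"
    with T(1) have ab: "a < card C" "b < card C" by auto
    have "(mat_adjoint N * N) $$ (a, b) = (\<Sum>p<n. M $$ (pick C a, p) * M $$ (p, pick C b))"
      unfolding gram_entry[OF N ab] using ab cnjM pick_less[OF C] by (intro sum.cong) (auto simp: N_def)
    also have "\<dots> = submatrix (M * M) C C $$ (a, b)"
      unfolding T(2)[OF ab] by (rule mult_mat_entry[OF M M pick_less[OF C ab(1)] pick_less[OF C ab(2)], symmetric])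
    finally show "(mat_adjoint N * N) $$ (a, b) = submatrix (M * M) C C $$ (a, b)" .
  qed (use T(1) N in auto)
  moreover have "(N * mat_adjoint N) $$ (i, j) = (\<Sum>q\<in>C. M $$ (i, q) * M $$ (q, j))" if ij: "i < n" "j < n" for i j
  proof -
    have "(N * mat_adjoint N) $$ (i, j) = (\<Sum>a<card C. N $$ (i, a) * mat_adjoint N $$ (a, j))"
      by (rule mult_mat_entry[OF N mat_adjoint_carrier[OF N] ij])
    also have "\<dots> = (\<Sum>a<card C. M $$ (i, pick C a) * M $$ (pick C a, j))"
      using N ij cnjM pick_less[OF C] by (intro sum.cong) (auto simp: N_def)
    also have "\<dots> = (\<Sum>q\<in>C. M $$ (i, q) * M $$ (q, j))" by (rule sum_pick[OF fin])
    finally show ?thesis .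
  qed
  moreover obtain U where "U \<in> carrier_mat n (card C)" "isometry_mat U"
    "N * mat_adjoint N = U * (mat_adjoint N * N) * mat_adjoint U"
    using isometry_swaps_gram[OF N cardC] by blast
  ultimately have "block_isometry M C U" using M unfolding block_isometry_def by simp
  then show ?thesis ..
qed

lemma row_gram_root:
  assumes A: "A \<in> carrier_mat d d'" and P: "P \<subseteq> {..<d}"
  shows "\<exists>M. M \<in> carrier_mat d' d' \<and> mat_adjoint M = M \<and> M * M = row_gram A P"
proof -
  \<comment> \<open>Setting the rows outside \<open>P\<close> to zero keeps the Gram matrix and avoids renumbering the rows.\<close>
  define B where "B = mat d d' (\<lambda>(p, q). if p \<in> P then A $$ (p, q) else 0)"
  have B: "B \<in> carrier_mat d d'" by (simp add: B_def)
  have "row_gram A P = mat_adjoint B * B"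
  proof (rule eq_matI)
    fix i j assume "i < dim_row (mat_adjoint B * B)" "j < dim_col (mat_adjoint B * B)"
    with B have ij: "i < d'" "j < d'" by auto
    have "(mat_adjoint B * B) $$ (i, j) = (\<Sum>p<d. if p \<in> P then cnj (A $$ (p, i)) * A $$ (p, j) else 0)"
      unfolding gram_entry[OF B ij] using ij by (intro sum.cong) (auto simp: B_def)
    also have "\<dots> = (\<Sum>p\<in>P. cnj (A $$ (p, i)) * A $$ (p, j))"
      using P by (simp add: sum.inter_restrict[symmetric] Int_absorb1)
    finally show "row_gram A P $$ (i, j) = (mat_adjoint B * B) $$ (i, j)"
      using row_gram_index[OF A ij] by simp
  qed (use A B in \<open>simp_all add: row_gram_def\<close>)
  with mat_abs_properties[OF B] show ?thesis by metis
qed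

text \<open>The point is the shape of the right-hand side: for fixed \<open>U\<close> and \<open>C\<close> the entry is a sum over \<open>P\<close> of terms
that do not involve \<open>P\<close>, so it is additive over blocks stacked in the columns \<open>C\<close>.\<close>

lemma sandwich_row_gram:
  assumes A: "A \<in> carrier_mat d d'" and P: "P \<subseteq> {..<d}" and C: "C \<subseteq> {..<d'}"
    and U: "U \<in> carrier_mat n (card C)" and ij: "i < n" "j < n"
  shows "(U * submatrix (row_gram A P) C C * mat_adjoint U) $$ (i, j) =
    (\<Sum>p\<in>P. (\<Sum>a<card C. U $$ (i, a) * cnj (A $$ (p, pick C a))) *
      (\<Sum>b<card C. A $$ (p, pick C b) * cnj (U $$ (j, b))))"
proof -
  let ?X = "submatrix (row_gram A P) C C"
  note X = submatrix_within[OF row_gram_carrier[OF A] C C]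
  have XP: "?X $$ (a, b) = (\<Sum>p\<in>P. cnj (A $$ (p, pick C a)) * A $$ (p, pick C b))"
    if "a < card C" "b < card C" for a b
    using X(2)[OF that] row_gram_index[OF A pick_less[OF C that(1)] pick_less[OF C that(2)]] by simp
  have "(U * ?X * mat_adjoint U) $$ (i, j) = (\<Sum>b<card C. (U * ?X) $$ (i, b) * mat_adjoint U $$ (b, j))"
    by (rule mult_mat_entry[OF mult_carrier_mat[OF U X(1)] mat_adjoint_carrier[OF U] ij])
  also have "\<dots> = (\<Sum>b<card C. (\<Sum>a<card C. U $$ (i, a) * ?X $$ (a, b)) * cnj (U $$ (j, b)))"
    using U ij mult_mat_entry[OF U X(1) ij(1)] by (intro sum.cong) (auto simp del: index_mult_mat)
  also have "\<dots> = (\<Sum>b<card C. \<Sum>a<card C. \<Sum>p\<in>P.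
      (U $$ (i, a) * cnj (A $$ (p, pick C a))) * (A $$ (p, pick C b) * cnj (U $$ (j, b))))"
    unfolding sum_distrib_right
  proof (intro sum.cong refl)
    fix a b assume "b \<in> {..<card C}" "a \<in> {..<card C}"
    then have ab: "a < card C" "b < card C" by simp_all
    show "U $$ (i, a) * ?X $$ (a, b) * cnj (U $$ (j, b)) = (\<Sum>p\<in>P.
        (U $$ (i, a) * cnj (A $$ (p, pick C a))) * (A $$ (p, pick C b) * cnj (U $$ (j, b))))"
      by (simp add: XP[OF ab] sum_distrib_left sum_distrib_right mult.assoc)
  qed
  also have "\<dots> = (\<Sum>b<card C. \<Sum>p\<in>P. \<Sum>a<card C.
      (U $$ (i, a) * cnj (A $$ (p, pick C a))) * (A $$ (p, pick C b) * cnj (U $$ (j, b))))"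
    by (rule sum.cong[OF refl sum.swap])
  also have "\<dots> = (\<Sum>p\<in>P. \<Sum>b<card C. \<Sum>a<card C.
      (U $$ (i, a) * cnj (A $$ (p, pick C a))) * (A $$ (p, pick C b) * cnj (U $$ (j, b))))"
    by (rule sum.swap)
  also have "\<dots> = (\<Sum>p\<in>P. \<Sum>a<card C. \<Sum>b<card C.
      (U $$ (i, a) * cnj (A $$ (p, pick C a))) * (A $$ (p, pick C b) * cnj (U $$ (j, b))))"
    by (rule sum.cong[OF refl sum.swap])
  also have "\<dots> = (\<Sum>p\<in>P. (\<Sum>a<card C. U $$ (i, a) * cnj (A $$ (p, pick C a))) *
      (\<Sum>b<card C. A $$ (p, pick C b) * cnj (U $$ (j, b))))"
    by (simp only: sum_product)
  finally show ?thesis .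
qed

section \<open>Summation over a compatible partitioning\<close>

lemma block_partition_blocks:
  assumes "block_partition d d' r R C" "k < r"
  shows "R k \<noteq> {}" "C k \<noteq> {}" "R k \<subseteq> {..<d}" "C k \<subseteq> {..<d'}"
proof -
  have "consecutive (R k)" "consecutive (C k)" "R k \<times> C k \<subseteq> {..<d} \<times> {..<d'}"
    using assms unfolding block_partition_def by auto
  moreover from this show ne: "R k \<noteq> {}" "C k \<noteq> {}" unfolding consecutive_def by auto
  ultimately show "R k \<subseteq> {..<d}" "C k \<subseteq> {..<d'}" by (auto simp: times_subset_iff)
qed

lemma block_partition_cover:
  assumes "block_partition d d' r R C" "p < d" "q < d'"
  obtains k where "k < r" "p \<in> R k" "q \<in> C k"
proof -
  have "(p, q) \<in> (\<Union>k<r. R k \<times> C k)" using assms unfolding block_partition_def by auto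
  then show ?thesis using that by auto
qed

text \<open>Exchanging rows and columns turns row compatibility into column compatibility, so that the summation
lemmas below serve both cases of the theorem.\<close>

lemma block_partition_transpose:
  assumes "block_partition d d' r R C"
  shows "block_partition d' d r C R"
proof -
  have "(\<Union>k<r. C k \<times> R k) = (\<Union>k<r. R k \<times> C k)\<inverse>" by auto
  also have "\<dots> = {..<d'} \<times> {..<d}" using assms by (auto simp: block_partition_def)
  finally have "(\<Union>k<r. C k \<times> R k) = {..<d'} \<times> {..<d}" .
  moreover have "disjoint_family_on (\<lambda>k. C k \<times> R k) {..<r}"
    using assms unfolding block_partition_def disjoint_family_on_def by blast
  ultimately show ?thesis using assms unfolding block_partition_def by auto
qed

text \<open>The blocks with a given column set \<open>c\<close> have row sets that partition all the rows: through a fixed column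
in \<open>c\<close>, every row meets some block, and by compatibility that block has column set \<open>c\<close>.\<close>

lemma sum_blocks_by_column:
  fixes F :: "nat set \<Rightarrow> nat \<Rightarrow> complex"
  assumes part: "block_partition d d' r R C" and comp: "column_compatible r C"
  shows "(\<Sum>k<r. \<Sum>p\<in>R k. F (C k) p) = (\<Sum>c\<in>C ` {..<r}. \<Sum>p<d. F c p)"
proof -
  have "(\<Sum>k<r. \<Sum>p\<in>R k. F (C k) p) = (\<Sum>c\<in>C ` {..<r}. \<Sum>k\<in>{k \<in> {..<r}. C k = c}. \<Sum>p\<in>R k. F (C k) p)"
    by (rule sum.image_gen) simp
  also have "\<dots> = (\<Sum>c\<in>C ` {..<r}. \<Sum>p<d. F c p)"
  proof (rule sum.cong[OF refl])
    fix c assume "c \<in> C ` {..<r}"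
    then obtain l where l: "l < r" "c = C l" by auto
    let ?K = "{k \<in> {..<r}. C k = c}"
    obtain q where q: "q \<in> c" using block_partition_blocks(2)[OF part l(1)] l by auto
    have qd: "q < d'" using block_partition_blocks(4)[OF part l(1)] l q by auto
    have "(\<Union>k\<in>?K. R k) = {..<d}"
    proof
      show "(\<Union>k\<in>?K. R k) \<subseteq> {..<d}" using block_partition_blocks(3)[OF part] by auto
      show "{..<d} \<subseteq> (\<Union>k\<in>?K. R k)"
      proof
        fix p assume "p \<in> {..<d}"
        then obtain k where k: "k < r" "p \<in> R k" "q \<in> C k" using block_partition_cover[OF part _ qd] by auto
        then have "C k = c" using comp l q unfolding column_compatible_def by blast
        then show "p \<in> (\<Union>k\<in>?K. R k)" using k by auto
      qed
    qed
    moreover have "R k \<inter> R k' = {}" if "k \<in> ?K" "k' \<in> ?K" "k \<noteq> k'" for k k'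
    proof -
      have "(R k \<times> C k) \<inter> (R k' \<times> C k') = {}"
        using part that unfolding block_partition_def disjoint_family_on_def by blast
      then show ?thesis using that q by auto
    qed
    moreover have "finite (R k)" if "k \<in> ?K" for k
      using block_partition_blocks(3)[OF part, of k] that finite_subset by auto
    ultimately have "(\<Sum>p<d. F c p) = (\<Sum>k\<in>?K. \<Sum>p\<in>R k. F c p)"
      using sum.UNION_disjoint[of ?K R "F c"] by auto
    then show "(\<Sum>k\<in>?K. \<Sum>p\<in>R k. F (C k) p) = (\<Sum>p<d. F c p)" by simp
  qed
  finally show ?thesis .
qed

text \<open>Without rows there are no blocks, so \<open>0 < d\<close> is what makes the column sets cover all the columns.\<close>

lemma sum_over_column_sets:
  fixes g :: "nat \<Rightarrow> complex"
  assumes part: "block_partition d d' r R C" and comp: "column_compatible r C" and d: "0 < d"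
  shows "(\<Sum>c\<in>C ` {..<r}. \<Sum>q\<in>c. g q) = (\<Sum>q<d'. g q)"
proof -
  have "{..<d'} \<subseteq> \<Union> (C ` {..<r})" using block_partition_cover[OF part d] by blast
  then have "\<Union> (C ` {..<r}) = {..<d'}" using block_partition_blocks(4)[OF part] by blast
  moreover have "sum g (\<Union> (C ` {..<r})) = (\<Sum>c\<in>C ` {..<r}. sum g c)"
  proof (rule sum.Union_disjoint[unfolded comp_def])
    show "\<forall>c\<in>C ` {..<r}. finite c" using block_partition_blocks(4)[OF part] finite_subset by blast
    show "\<forall>c\<in>C ` {..<r}. \<forall>c'\<in>C ` {..<r}. c \<noteq> c' \<longrightarrow> c \<inter> c' = {}"
      using comp unfolding column_compatible_def by blast
  qed
  ultimately show ?thesis by simp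
qed

section \<open>Decomposition along a row or column compatible partitioning\<close>

theorem theorem2p1:
  fixes A :: "complex mat"
    and d d' r :: nat
    and R C :: "nat \<Rightarrow> nat set"
    and n m :: "nat \<Rightarrow> nat"
  assumes "A \<in> carrier_mat d d'"
    and "block_partition d d' r R C"
    and "\<And>k. k < r \<Longrightarrow> submatrix A (R k) (C k) \<in> carrier_mat (n k) (m k)"
    and "row_compatible r R \<or> column_compatible r C"
  shows "\<exists>U :: nat \<Rightarrow> complex mat.
    (\<forall>k<r. U k \<in> carrier_mat d' (m k) \<and> isometry_mat (U k)) \<and>
    mat_abs A ^\<^sub>m 2 =
      (\<Oplus>\<^bsub>ring_mat TYPE(complex) d' ()\<^esub> k\<in>{..<r}.
        U k * mat_abs (submatrix A (R k) (C k)) ^\<^sub>m 2 * mat_adjoint (U k))"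
proof -
  note A = assms(1) and part = assms(2)
  note blocks = block_partition_blocks[OF part]
  note block = submatrix_within[OF A blocks(3,4)]
  have m: "m k = card (C k)" if "k < r" for k
    using assms(3)[OF that] block(1)[OF that that] by auto
  define summand where "summand U k = U k * submatrix (row_gram A (R k)) (C k) (C k) * mat_adjoint (U k)"
    for U :: "nat \<Rightarrow> complex mat" and k
  \<comment> \<open>With \<open>|S|\<^sup>2\<close> replaced by Gram matrices throughout, only an identity between entries remains.\<close>
  have reduce: ?thesis
    if U: "\<And>k. k < r \<Longrightarrow> U k \<in> carrier_mat d' (card (C k)) \<and> isometry_mat (U k)"
      and entry: "\<And>i j. i < d' \<Longrightarrow> j < d' \<Longrightarrow> row_gram A {..<d} $$ (i, j) = (\<Sum>k<r. summand U k $$ (i, j))" for U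
  proof (intro exI conjI)
    show "\<forall>k<r. U k \<in> carrier_mat d' (m k) \<and> isometry_mat (U k)" using U m by simp
    let ?F = "\<lambda>k. U k * mat_abs (submatrix A (R k) (C k)) ^\<^sub>m 2 * mat_adjoint (U k)"
    have F: "?F k = summand U k" if "k < r" for k
      unfolding summand_def mat_abs_pow2[OF block(1)[OF that that]] gram_submatrix[OF A blocks(3,4)[OF that]] ..
    have Fc: "?F k \<in> carrier_mat d' d'" if "k < r" for k
      using U[OF that] by (intro carrier_matI) auto
    note sum = finsum_ring_mat[of "{..<r}" ?F d']
    show "mat_abs A ^\<^sub>m 2 = (\<Oplus>\<^bsub>ring_mat TYPE(complex) d' ()\<^esub> k\<in>{..<r}. ?F k)"
      unfolding mat_abs_pow2[OF A] gram_eq_row_gram[OF A]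
    proof (rule eq_matI)
      fix i j
      assume "i < dim_row (\<Oplus>\<^bsub>ring_mat TYPE(complex) d' ()\<^esub> k\<in>{..<r}. ?F k)"
        "j < dim_col (\<Oplus>\<^bsub>ring_mat TYPE(complex) d' ()\<^esub> k\<in>{..<r}. ?F k)"
      with sum(1) Fc have ij: "i < d'" "j < d'" by auto
      have "(\<Oplus>\<^bsub>ring_mat TYPE(complex) d' ()\<^esub> k\<in>{..<r}. ?F k) $$ (i, j) = (\<Sum>k<r. ?F k $$ (i, j))"
        by (rule sum(2)[OF _ _ ij]) (use Fc in auto)
      then show "row_gram A {..<d} $$ (i, j) =
          (\<Oplus>\<^bsub>ring_mat TYPE(complex) d' ()\<^esub> k\<in>{..<r}. ?F k) $$ (i, j)"
        unfolding entry[OF ij] using F by simp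
    qed (use sum(1) Fc row_gram_carrier[OF A] in auto)
  qed
  from assms(4) show ?thesis
  proof
    assume "row_compatible r R"
    then have comp: "column_compatible r R" by (simp add: row_compatible_def column_compatible_def)
    note part' = block_partition_transpose[OF part]
    \<comment> \<open>One root for each strip; the isometry of a block belongs to the root of its own strip.\<close>
    obtain M where M: "\<And>P. P \<subseteq> {..<d} \<Longrightarrow> M P \<in> carrier_mat d' d'"
        "\<And>P. P \<subseteq> {..<d} \<Longrightarrow> mat_adjoint (M P) = M P"
        "\<And>P. P \<subseteq> {..<d} \<Longrightarrow> M P * M P = row_gram A P"
      using row_gram_root[OF A] by metis
    have "\<exists>U. block_isometry (M (R k)) (C k) U" if "k < r" for k
      using block_isometry_exists[OF M(1,2) blocks(4)] blocks(3) that by blast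
    then obtain U where BI: "\<And>k. k < r \<Longrightarrow> block_isometry (M (R k)) (C k) (U k)" by metis
    have U: "U k \<in> carrier_mat d' (card (C k)) \<and> isometry_mat (U k)" if "k < r" for k
      using block_isometryD(1,2)[OF BI M(1)] blocks(3) that by blast
    have UM: "summand U k $$ (i, j) = (\<Sum>q\<in>C k. M (R k) $$ (i, q) * M (R k) $$ (q, j))"
      if "k < r" "i < d'" "j < d'" for k i j
      using block_isometryD(3)[OF BI M(1)[OF blocks(3)]] M(3)[OF blocks(3)] that
      by (simp add: summand_def)
    show ?thesis
    proof (rule reduce[of U, OF U])
      fix i j assume ij: "i < d'" "j < d'"
      have "(\<Sum>k<r. summand U k $$ (i, j)) = (\<Sum>k<r. \<Sum>q\<in>C k. M (R k) $$ (i, q) * M (R k) $$ (q, j))"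
        using UM ij by simp
      also have "\<dots> = (\<Sum>P\<in>R ` {..<r}. \<Sum>q<d'. M P $$ (i, q) * M P $$ (q, j))"
        by (rule sum_blocks_by_column[OF part' comp])
      also have "\<dots> = (\<Sum>P\<in>R ` {..<r}. \<Sum>p\<in>P. cnj (A $$ (p, i)) * A $$ (p, j))"
      proof (rule sum.cong[OF refl])
        fix P assume "P \<in> R ` {..<r}"
        then have "P \<subseteq> {..<d}" using blocks(3) by auto
        from M(1,3)[OF this] show "(\<Sum>q<d'. M P $$ (i, q) * M P $$ (q, j)) = (\<Sum>p\<in>P. cnj (A $$ (p, i)) * A $$ (p, j))"
          using mult_mat_entry[of "M P" d' d' "M P" d', OF _ _ ij] row_gram_index[OF A ij] by metis
      qed
      also have "\<dots> = (\<Sum>p<d. cnj (A $$ (p, i)) * A $$ (p, j))"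
        by (rule sum_over_column_sets[OF part' comp]) (use ij in simp)
      finally show "row_gram A {..<d} $$ (i, j) = (\<Sum>k<r. summand U k $$ (i, j))"
        using row_gram_index[OF A ij] by simp
    qed simp
  next
    assume comp: "column_compatible r C"
    \<comment> \<open>One root for the whole of \<open>A\<close>; blocks in the same columns share their isometry.\<close>
    obtain M where M: "M \<in> carrier_mat d' d'" "mat_adjoint M = M" "M * M = row_gram A {..<d}"
      using row_gram_root[OF A subset_refl] by blast
    then obtain W where BI: "\<And>c. c \<subseteq> {..<d'} \<Longrightarrow> block_isometry M c (W c)"
      using block_isometry_exists by metis
    have W: "W c \<in> carrier_mat d' (card c)" "isometry_mat (W c)" if "c \<subseteq> {..<d'}" for c
      using block_isometryD(1,2)[OF BI[OF that] M(1)] by blast+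
    show ?thesis
    proof (rule reduce[of "\<lambda>k. W (C k)"])
      show "W (C k) \<in> carrier_mat d' (card (C k)) \<and> isometry_mat (W (C k))" if "k < r" for k
        using W blocks(4)[OF that] by blast
      fix i j assume ij: "i < d'" "j < d'"
      define f where "f c p = (\<Sum>a<card c. W c $$ (i, a) * cnj (A $$ (p, pick c a))) *
          (\<Sum>b<card c. A $$ (p, pick c b) * cnj (W c $$ (j, b)))" for c p
      have f: "(W c * submatrix (row_gram A P) c c * mat_adjoint (W c)) $$ (i, j) = (\<Sum>p\<in>P. f c p)"
        if "P \<subseteq> {..<d}" "c \<subseteq> {..<d'}" for P c
        unfolding f_def by (rule sandwich_row_gram[OF A that W(1)[OF that(2)] ij])
      have "(\<Sum>k<r. summand (\<lambda>k. W (C k)) k $$ (i, j)) = (\<Sum>k<r. \<Sum>p\<in>R k. f (C k) p)"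
        using f blocks(3,4) by (simp add: summand_def)
      also have "\<dots> = (\<Sum>c\<in>C ` {..<r}. \<Sum>p<d. f c p)"
        by (rule sum_blocks_by_column[OF part comp])
      also have "\<dots> = (\<Sum>p<d. cnj (A $$ (p, i)) * A $$ (p, j))"
      proof (cases "d = 0")
        case False
        have "(\<Sum>c\<in>C ` {..<r}. \<Sum>p<d. f c p) = (\<Sum>c\<in>C ` {..<r}. \<Sum>q\<in>c. M $$ (i, q) * M $$ (q, j))"
        proof (rule sum.cong[OF refl])
          fix c assume "c \<in> C ` {..<r}"
          then have "c \<subseteq> {..<d'}" using blocks(4) by auto
          then show "(\<Sum>p<d. f c p) = (\<Sum>q\<in>c. M $$ (i, q) * M $$ (q, j))"
            using f[of "{..<d}" c] block_isometryD(3)[OF BI M(1) ij] M(3) by simp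
        qed
        also have "\<dots> = (\<Sum>q<d'. M $$ (i, q) * M $$ (q, j))"
          by (rule sum_over_column_sets[OF part comp]) (use False in simp)
        also have "\<dots> = (\<Sum>p<d. cnj (A $$ (p, i)) * A $$ (p, j))"
          using mult_mat_entry[OF M(1) M(1) ij] M(3) row_gram_index[OF A ij] by metis
        finally show ?thesis .
      qed simp
      finally show "row_gram A {..<d} $$ (i, j) = (\<Sum>k<r. summand (\<lambda>k. W (C k)) k $$ (i, j))"
        using row_gram_index[OF A ij] by simp
    qed
  qed
qed

end
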